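(* Let $S$ be a $\Gamma$-semigroup. Then: $S$ is left simple if and only if $S$ is fuzzy left simple; $S$ is right simple if and only if $S$ is fuzzy right simple; and $S$ is simple if and only if $S$ is fuzzy simple.
   Context: Let $S$ and $\Gamma$ be non-empty sets. $S$ is a $\Gamma$-semigroup if there is a map $S\times\Gamma\times S\to S$, written $(a,\alpha,b)\mapsto a\alpha b$, with $(x\beta y)\gamma z=x\beta(y\gamma z)$ for all $x,y,z\in S$, $\beta,\gamma\in\Gamma$. For $A,B\subseteq S$, $A\Gamma B=\{a\gamma b: a\in A,b\in B,\gamma\in\Gamma\}$. A left (right) ideal of $S$ is a non-empty $I\subseteq S$ with $S\Gamma I\subseteq I$ ($I\Gamma S\subseteq I$); an ideal is both a left and a right ideal. $S$ is left simple (right simple, simple) if it has no proper left ideals (right ideals, ideals), i.e. the only one is $S$ itself. A fuzzy subset of $S$ is a function $\mu:S\to[0,1]$; it is non-empty if it is not identically $0$. A non-empty fuzzy subset $\mu$ is a fuzzy left ideal if $\mu(x\gamma y)\ge\mu(y)$ for all $x,y\in S,\gamma\in\Gamma$; a fuzzy right ideal if $\mu(x\gamma y)\ge\mu(x)$ for all $x,y\in S,\gamma\in\Gamma$; a fuzzy ideal if it is both. $S$ is fuzzy left simple (fuzzy right simple, fuzzy simple) if every fuzzy left ideal (fuzzy right ideal, fuzzy ideal) of $S$ is a constant function. *)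

theory Defs
  imports "HOL-Analysis.Abstract_Topology_2" "HOL-Library.FuncSet"
begin

(* S and G are carrier sets of arbitrary ambient types; m x g y is the product x g y.
   Outside the carriers m is unspecified, so every condition below is relativised to S and G. *)
locale gamma_semigroup =
  fixes S :: "'a set" and G :: "'g set" and m :: "'a \<Rightarrow> 'g \<Rightarrow> 'a \<Rightarrow> 'a"
  assumes S_nonempty: "S \<noteq> {}"
    and G_nonempty: "G \<noteq> {}"
    and closed: "\<lbrakk>x \<in> S; \<gamma> \<in> G; y \<in> S\<rbrakk> \<Longrightarrow> m x \<gamma> y \<in> S"
    and assoc: "\<lbrakk>x \<in> S; y \<in> S; z \<in> S; \<beta> \<in> G; \<gamma> \<in> G\<rbrakk>
      \<Longrightarrow> m (m x \<beta> y) \<gamma> z = m x \<beta> (m y \<gamma> z)"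

definition gamma_prod :: "('a \<Rightarrow> 'g \<Rightarrow> 'a \<Rightarrow> 'a) \<Rightarrow> 'a set \<Rightarrow> 'g set \<Rightarrow> 'a set \<Rightarrow> 'a set" where
  "gamma_prod m A G B = {m a \<gamma> b | a \<gamma> b. a \<in> A \<and> \<gamma> \<in> G \<and> b \<in> B}"

definition left_ideal :: "'a set \<Rightarrow> 'g set \<Rightarrow> ('a \<Rightarrow> 'g \<Rightarrow> 'a \<Rightarrow> 'a) \<Rightarrow> 'a set \<Rightarrow> bool" where
  "left_ideal S G m I \<longleftrightarrow> I \<noteq> {} \<and> I \<subseteq> S \<and> gamma_prod m S G I \<subseteq> I"

definition right_ideal :: "'a set \<Rightarrow> 'g set \<Rightarrow> ('a \<Rightarrow> 'g \<Rightarrow> 'a \<Rightarrow> 'a) \<Rightarrow> 'a set \<Rightarrow> bool" where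
  "right_ideal S G m I \<longleftrightarrow> I \<noteq> {} \<and> I \<subseteq> S \<and> gamma_prod m I G S \<subseteq> I"

definition two_sided_ideal :: "'a set \<Rightarrow> 'g set \<Rightarrow> ('a \<Rightarrow> 'g \<Rightarrow> 'a \<Rightarrow> 'a) \<Rightarrow> 'a set \<Rightarrow> bool" where
  "two_sided_ideal S G m I \<longleftrightarrow> left_ideal S G m I \<and> right_ideal S G m I"

definition left_simple :: "'a set \<Rightarrow> 'g set \<Rightarrow> ('a \<Rightarrow> 'g \<Rightarrow> 'a \<Rightarrow> 'a) \<Rightarrow> bool" where
  "left_simple S G m \<longleftrightarrow> (\<forall>I. left_ideal S G m I \<longrightarrow> I = S)"

definition right_simple :: "'a set \<Rightarrow> 'g set \<Rightarrow> ('a \<Rightarrow> 'g \<Rightarrow> 'a \<Rightarrow> 'a) \<Rightarrow> bool" where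
  "right_simple S G m \<longleftrightarrow> (\<forall>I. right_ideal S G m I \<longrightarrow> I = S)"

definition gamma_simple :: "'a set \<Rightarrow> 'g set \<Rightarrow> ('a \<Rightarrow> 'g \<Rightarrow> 'a \<Rightarrow> 'a) \<Rightarrow> bool" where
  "gamma_simple S G m \<longleftrightarrow> (\<forall>I. two_sided_ideal S G m I \<longrightarrow> I = S)"

(* A fuzzy subset of S is a total HOL function of which only the restriction to S matters. *)
definition nonempty_fuzzy_subset :: "'a set \<Rightarrow> ('a \<Rightarrow> real) \<Rightarrow> bool" where
  "nonempty_fuzzy_subset S \<mu> \<longleftrightarrow> \<mu> \<in> S \<rightarrow> {0..1} \<and> (\<exists>x\<in>S. \<mu> x \<noteq> 0)"

definition fuzzy_left_ideal ::
    "'a set \<Rightarrow> 'g set \<Rightarrow> ('a \<Rightarrow> 'g \<Rightarrow> 'a \<Rightarrow> 'a) \<Rightarrow> ('a \<Rightarrow> real) \<Rightarrow> bool" where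
  "fuzzy_left_ideal S G m \<mu> \<longleftrightarrow>
     nonempty_fuzzy_subset S \<mu> \<and> (\<forall>x\<in>S. \<forall>y\<in>S. \<forall>\<gamma>\<in>G. \<mu> (m x \<gamma> y) \<ge> \<mu> y)"

definition fuzzy_right_ideal ::
    "'a set \<Rightarrow> 'g set \<Rightarrow> ('a \<Rightarrow> 'g \<Rightarrow> 'a \<Rightarrow> 'a) \<Rightarrow> ('a \<Rightarrow> real) \<Rightarrow> bool" where
  "fuzzy_right_ideal S G m \<mu> \<longleftrightarrow>
     nonempty_fuzzy_subset S \<mu> \<and> (\<forall>x\<in>S. \<forall>y\<in>S. \<forall>\<gamma>\<in>G. \<mu> (m x \<gamma> y) \<ge> \<mu> x)"

definition fuzzy_ideal ::
    "'a set \<Rightarrow> 'g set \<Rightarrow> ('a \<Rightarrow> 'g \<Rightarrow> 'a \<Rightarrow> 'a) \<Rightarrow> ('a \<Rightarrow> real) \<Rightarrow> bool" where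
  "fuzzy_ideal S G m \<mu> \<longleftrightarrow> fuzzy_left_ideal S G m \<mu> \<and> fuzzy_right_ideal S G m \<mu>"

definition fuzzy_left_simple :: "'a set \<Rightarrow> 'g set \<Rightarrow> ('a \<Rightarrow> 'g \<Rightarrow> 'a \<Rightarrow> 'a) \<Rightarrow> bool" where
  "fuzzy_left_simple S G m \<longleftrightarrow> (\<forall>\<mu>. fuzzy_left_ideal S G m \<mu> \<longrightarrow> \<mu> constant_on S)"

definition fuzzy_right_simple :: "'a set \<Rightarrow> 'g set \<Rightarrow> ('a \<Rightarrow> 'g \<Rightarrow> 'a \<Rightarrow> 'a) \<Rightarrow> bool" where
  "fuzzy_right_simple S G m \<longleftrightarrow> (\<forall>\<mu>. fuzzy_right_ideal S G m \<mu> \<longrightarrow> \<mu> constant_on S)"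

definition fuzzy_simple :: "'a set \<Rightarrow> 'g set \<Rightarrow> ('a \<Rightarrow> 'g \<Rightarrow> 'a \<Rightarrow> 'a) \<Rightarrow> bool" where
  "fuzzy_simple S G m \<longleftrightarrow> (\<forall>\<mu>. fuzzy_ideal S G m \<mu> \<longrightarrow> \<mu> constant_on S)"

end

theory Submission
  imports Defs
begin

text \<open>
  The characteristic function of an ideal is a fuzzy ideal, and it is constant only if the ideal
  is all of \<open>S\<close>. Conversely, each superlevel set \<open>{x \<in> S. \<mu> x \<ge> \<mu> a}\<close> of a fuzzy ideal \<open>\<mu>\<close>
  contains \<open>a\<close> and is an ideal; if all these sets equal \<open>S\<close>, any two values of \<open>\<mu>\<close> coincide.
\<close>

text \<open>The product and the side of the ideals enter only through \<open>ind\<close> and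
  \<open>level\<close>, so this one argument serves the left, right and two-sided cases.\<close>

lemma only_full_set_iff_constant_on:
  fixes ideal :: "'a set \<Rightarrow> bool" and fuzzy :: "('a \<Rightarrow> real) \<Rightarrow> bool"
  assumes sub: "\<And>I. ideal I \<Longrightarrow> I \<noteq> {} \<and> I \<subseteq> S"
    and ind: "\<And>I. ideal I \<Longrightarrow> fuzzy (indicator I)"
    and level: "\<And>\<mu> a. fuzzy \<mu> \<Longrightarrow> a \<in> S \<Longrightarrow> ideal {x \<in> S. \<mu> x \<ge> \<mu> a}"
  shows "(\<forall>I. ideal I \<longrightarrow> I = S) \<longleftrightarrow> (\<forall>\<mu>. fuzzy \<mu> \<longrightarrow> \<mu> constant_on S)"
proof (intro iffI allI impI)
  fix \<mu> assume full: "\<forall>I. ideal I \<longrightarrow> I = S" and "fuzzy \<mu>"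
  then have "{x \<in> S. \<mu> x \<ge> \<mu> a} = S" if "a \<in> S" for a
    using level that by blast
  \<comment> \<open>\<open>a\<close> and \<open>b\<close> are arbitrary, so exchanging them gives
    the reverse inequality.\<close>
  then have "\<mu> b \<ge> \<mu> a" if "a \<in> S" "b \<in> S" for a b
    using that by blast
  then show "\<mu> constant_on S"
    unfolding constant_on_def by (meson order_antisym)
next
  fix I assume const: "\<forall>\<mu>. fuzzy \<mu> \<longrightarrow> \<mu> constant_on S" and I: "ideal I"
  then obtain c where c: "\<And>x. x \<in> S \<Longrightarrow> indicator I x = (c :: real)"
    using ind unfolding constant_on_def by blast
  obtain a where "a \<in> I" "a \<in> S"
    using sub[OF I] by blast
  \<comment> \<open>A point of the non-empty set \<open>I\<close> fixes the constant, ruling out the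
    value 0.\<close>
  then have "c = 1"
    using c[of a] by simp
  then have "S \<subseteq> I"
    using c by (auto simp: indicator_eq_1_iff)
  then show "I = S"
    using sub[OF I] by blast
qed

lemma nonempty_fuzzy_subset_indicator:
  "I \<noteq> {} \<Longrightarrow> I \<subseteq> S \<Longrightarrow> nonempty_fuzzy_subset S (indicator I)"
  unfolding nonempty_fuzzy_subset_def by (auto simp: indicator_def)

text \<open>The inequality has content only for \<open>y\<close> in \<open>I\<close>; there
  absorption keeps the product in \<open>I\<close>, so both sides are 1.\<close>

lemma fuzzy_left_ideal_indicator:
  "left_ideal S G m I \<Longrightarrow> fuzzy_left_ideal S G m (indicator I)"
  using nonempty_fuzzy_subset_indicator[of I S]
  unfolding left_ideal_def fuzzy_left_ideal_def gamma_prod_def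
  by (auto simp: indicator_def) blast

lemma fuzzy_right_ideal_indicator:
  "right_ideal S G m I \<Longrightarrow> fuzzy_right_ideal S G m (indicator I)"
  using nonempty_fuzzy_subset_indicator[of I S]
  unfolding right_ideal_def fuzzy_right_ideal_def gamma_prod_def
  by (auto simp: indicator_def) blast

context gamma_semigroup
begin

text \<open>Membership passes to products by \<mu>(x\<gamma>y) \<ge> \<mu>(y) \<ge> \<mu>(a);
  \<open>closed\<close> keeps them in \<open>S\<close>, and \<open>a\<close> itself is a
  member.\<close>

lemma left_ideal_superlevel:
  "fuzzy_left_ideal S G m \<mu> \<Longrightarrow> a \<in> S \<Longrightarrow> left_ideal S G m {x \<in> S. \<mu> x \<ge> \<mu> a}"
  unfolding left_ideal_def fuzzy_left_ideal_def gamma_prod_def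
  by (auto intro: closed order_trans)

lemma right_ideal_superlevel:
  "fuzzy_right_ideal S G m \<mu> \<Longrightarrow> a \<in> S \<Longrightarrow> right_ideal S G m {x \<in> S. \<mu> x \<ge> \<mu> a}"
  unfolding right_ideal_def fuzzy_right_ideal_def gamma_prod_def
  by (auto intro: closed order_trans)

lemma left_simple_iff_fuzzy_left_simple: "left_simple S G m \<longleftrightarrow> fuzzy_left_simple S G m"
  unfolding left_simple_def fuzzy_left_simple_def
  by (intro only_full_set_iff_constant_on fuzzy_left_ideal_indicator left_ideal_superlevel)
    (simp_all add: left_ideal_def)

lemma right_simple_iff_fuzzy_right_simple: "right_simple S G m \<longleftrightarrow> fuzzy_right_simple S G m"
  unfolding right_simple_def fuzzy_right_simple_def
  by (intro only_full_set_iff_constant_on fuzzy_right_ideal_indicator right_ideal_superlevel)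
    (simp_all add: right_ideal_def)

text \<open>This does not follow by conjoining the one-sided equivalences, since simplicity concerns
  only sets that are ideals on both sides. The constructions do combine: the same indicator and the
  same superlevel set work on either side.\<close>

lemma gamma_simple_iff_fuzzy_simple: "gamma_simple S G m \<longleftrightarrow> fuzzy_simple S G m"
  unfolding gamma_simple_def fuzzy_simple_def
proof (rule only_full_set_iff_constant_on)
  show "I \<noteq> {} \<and> I \<subseteq> S" if "two_sided_ideal S G m I" for I
    using that by (simp add: two_sided_ideal_def left_ideal_def)
  show "fuzzy_ideal S G m (indicator I)" if "two_sided_ideal S G m I" for I
    using that
    by (simp add: two_sided_ideal_def fuzzy_ideal_def
        fuzzy_left_ideal_indicator fuzzy_right_ideal_indicator)
  show "two_sided_ideal S G m {x \<in> S. \<mu> x \<ge> \<mu> a}" if "fuzzy_ideal S G m \<mu>" "a \<in> S" for \<mu> a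
    using that
    by (simp add: two_sided_ideal_def fuzzy_ideal_def left_ideal_superlevel right_ideal_superlevel)
qed

end

theorem theorem4p24:
  fixes S :: "'a set" and G :: "'g set" and m :: "'a \<Rightarrow> 'g \<Rightarrow> 'a \<Rightarrow> 'a"
  assumes "gamma_semigroup S G m"
  shows "(left_simple S G m \<longleftrightarrow> fuzzy_left_simple S G m) \<and>
         (right_simple S G m \<longleftrightarrow> fuzzy_right_simple S G m) \<and>
         (gamma_simple S G m \<longleftrightarrow> fuzzy_simple S G m)"
proof -
  interpret gamma_semigroup S G m by fact
  show ?thesis
    using left_simple_iff_fuzzy_left_simple right_simple_iff_fuzzy_right_simple
      gamma_simple_iff_fuzzy_simple by blast
qed

end
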